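(* Let $Y$ be a real random variable whose moment generating function $E[e^{tY}]$ exists for $|t|<r$, for some $r>0$. Then for any integers $n,k$ with $n\ge k\ge 0$ and every real $x$, $$B_{n,k}\Big(B_{1}^{(L,Y)}(x),B_{2}^{(L,Y)}(x),\dots,B_{n-k+1}^{(L,Y)}(x)\Big)=\sum_{j=k}^{n}{j\brace k}L_{Y}(n,j)x^{j}.$$
   Context: ${j\brace k}$ denotes the Stirling numbers of the second kind, given by $x^{n}=\sum_{k=0}^{n}{n\brace k}(x)_{k}$, where $(x)_0=1$, $(x)_k=x(x-1)\cdots(x-k+1)$. Partial Bell polynomials $B_{n,k}$ ($n\ge k\ge 0$) are defined by the formal power series identity $$\frac{1}{k!}\left(\sum_{j=1}^{\infty}x_{j}\frac{t^{j}}{j!}\right)^{k}=\sum_{n=k}^{\infty}B_{n,k}(x_{1},x_{2},\dots,x_{n-k+1})\frac{t^{n}}{n!}.$$ The probabilistic Lah numbers $L_Y(n,k)$ ($n\ge k\ge 0$) associated with $Y$ are defined by the power series expansion about $t=0$ $$\frac{1}{k!}\left(E\left[\left(\frac{1}{1-t}\right)^{Y}\right]-1\right)^{k}=\sum_{n=k}^{\infty}L_{Y}(n,k)\frac{t^{n}}{n!},\quad k\ge 0.$$ The probabilistic Lah-Bell polynomials associated with $Y$ are $B_{n}^{(L,Y)}(x)=\sum_{k=0}^{n}L_{Y}(n,k)x^{k}$, $n\ge 0$. *)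

theory Defs
  imports
    "HOL-Probability.Probability"
    "HOL-Analysis.FPS_Convergence"
    "HOL-Combinatorics.Stirling"
begin

lemma Stirling_falling_factorial:
  fixes x :: real
  shows "x ^ n = (\<Sum>k\<le>n. of_nat (Stirling n k) * (\<Prod>i<k. x - of_nat i))"
proof (induction n)
  case 0
  show ?case by simp
next
  case (Suc n)
  define p where "p k = (\<Prod>i<k. x - real i)" for k
  have p: "x * p k = p (Suc k) + real k * p k" for k
    by (simp add: p_def algebra_simps)
  have "x ^ Suc n = (\<Sum>k\<le>n. real (Stirling n k) * (x * p k))"
    by (simp add: Suc.IH p_def sum_distrib_left mult_ac)
  also have "\<dots> = (\<Sum>k\<le>n. real (Stirling n k) * p (Suc k))
      + (\<Sum>k\<le>n. real (Stirling n k) * real k * p k)"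
    by (simp add: p algebra_simps sum.distrib)
  also have "(\<Sum>k\<le>n. real (Stirling n k) * real k * p k)
      = (\<Sum>k\<le>Suc n. real (Stirling n k) * real k * p k)"
    by simp
  also have "\<dots> = (\<Sum>k\<le>n. real (Stirling n (Suc k)) * real (Suc k) * p (Suc k))"
    by (subst sum.atMost_Suc_shift) simp
  also have "(\<Sum>k\<le>n. real (Stirling n k) * p (Suc k)) + \<dots>
      = (\<Sum>k\<le>n. real (Stirling (Suc n) (Suc k)) * p (Suc k))"
    unfolding sum.distrib[symmetric] by (intro sum.cong) (simp_all add: algebra_simps)
  also have "\<dots> = (\<Sum>k\<le>Suc n. real (Stirling (Suc n) k) * p k)"
    by (subst sum.atMost_Suc_shift) simp
  finally show ?case by (simp add: p_def)
qed

text \<open>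
  The partial Bell polynomial \<open>B\<^bsub>n,k\<^esub>\<close> evaluated at \<open>x 1, x 2, \<dots>\<close>. The arguments are passed as a
  whole sequence; the entry \<open>x 0\<close> is never used, and the lemma \<open>partial_bell_cong\<close> shows that only
  \<open>x 1, \<dots>, x (n - k + 1)\<close> matter.
\<close>

definition partial_bell :: "nat \<Rightarrow> nat \<Rightarrow> (nat \<Rightarrow> real) \<Rightarrow> real" where
  "partial_bell n k x =
     fact n * fps_nth (fps_const (1 / fact k) *
       (Abs_fps (\<lambda>j. if j = 0 then 0 else x j / fact j)) ^ k) n"

lemma partial_bell_cong:
  assumes "k \<le> n" and eq: "\<And>j. 1 \<le> j \<Longrightarrow> j \<le> n - k + 1 \<Longrightarrow> x j = y j"
  shows "partial_bell n k x = partial_bell n k y"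
proof -
  define S where "S z = Abs_fps (\<lambda>j. z (Suc j) / fact (Suc j))" for z :: "nat \<Rightarrow> real"
  have X: "Abs_fps (\<lambda>j. if j = 0 then 0 else z j / fact j) = fps_X * S z" for z :: "nat \<Rightarrow> real"
    by (rule fps_ext) (auto simp: S_def gr0_conv_Suc)
  have "fps_nth (S x ^ m) i = fps_nth (S y ^ m) i" if "i \<le> n - k" for m i
    using that
  proof (induction m arbitrary: i)
    case (Suc m)
    have "fps_nth (S x) j = fps_nth (S y) j" if "j \<le> n - k" for j
      using eq[of "Suc j"] that by (simp add: S_def)
    with Suc show ?case by (auto simp: fps_mult_nth intro!: sum.cong)
  qed simp
  then show ?thesis
    using assms(1) by (simp add: partial_bell_def X power_mult_distrib fps_X_power_mult_nth)
qed

text \<open>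
  The description picks the power series about \<open>0\<close> representing the given function of \<open>t\<close> near \<open>0\<close>;
  it is unique when it exists, which is the case if the moment generating function of \<open>Y\<close> is finite
  near \<open>0\<close>.
\<close>

definition prob_lah :: "'a measure \<Rightarrow> ('a \<Rightarrow> real) \<Rightarrow> nat \<Rightarrow> nat \<Rightarrow> real" where
  "prob_lah M Y n k =
     fact n * fps_nth (THE F. (\<lambda>t::real.
       1 / fact k * (integral\<^sup>L M (\<lambda>\<omega>. (1 / (1 - t)) powr Y \<omega>) - 1) ^ k) has_fps_expansion F) n"

definition prob_lah_bell :: "'a measure \<Rightarrow> ('a \<Rightarrow> real) \<Rightarrow> nat \<Rightarrow> real \<Rightarrow> real" where
  "prob_lah_bell M Y n x = (\<Sum>k=0..n. prob_lah M Y n k * x ^ k)"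

end

theory Submission
  imports Defs
begin

text \<open>
  Near \<open>0\<close>, the binomial series gives
  \<open>E[(1 - t)\<^bsup>-Y\<^esup>] = \<Sum>n. E[Y (Y + 1) \<cdots> (Y + n - 1)] t\<^sup>n / n!\<close>; interchanging sum and expectation is
  justified because the sum of the absolute values is at most \<open>(1 - \<bar>t\<bar>)\<^bsup>-\<bar>Y\<bar>\<^esup>\<close>, which is integrable
  for small \<open>t\<close>. Let \<open>F\<close> be this series minus \<open>1\<close>, so that \<open>L\<^sub>Y(n,k)/n!\<close> is the \<open>n\<close>-th coefficient of
  \<open>F\<^sup>k/k!\<close>, and the series with coefficients \<open>B\<^sub>n\<^bsup>(L,Y)\<^esup>(x)/n!\<close> is \<open>e\<^bsup>x F\<^esup>\<close>. The claim is then the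
  substitution of \<open>F\<close> into \<open>(e\<^bsup>x t\<^esup> - 1)\<^sup>k/k! = \<Sum>j. S(j,k) x\<^sup>j t\<^sup>j/j!\<close>.
\<close>

text \<open>Evaluation at 0 gives the constant coefficient; differentiating shifts the remaining
  coefficients down while the zero function stays zero, so induction reaches all of them.\<close>

lemma has_fps_expansion_zero_imp_zero:
  fixes F :: "'a :: {banach, real_normed_field} fps"
  assumes "(\<lambda>_. 0) has_fps_expansion F"
  shows "F = 0"
proof -
  have "fps_nth F n = 0" for n
    using assms
  proof (induction n arbitrary: F)
    case 0
    then have "eval_fps F 0 = 0"
      unfolding has_fps_expansion_def by (blast dest: eventually_nhds_x_imp_x)
    then show ?case by (simp add: eval_fps_at_0)
  next
    case (Suc n)
    from has_fps_expansion_deriv[OF Suc.prems]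
    have "(\<lambda>_. 0) has_fps_expansion fps_deriv F" by simp
    from Suc.IH[OF this] show ?case by (simp del: of_nat_Suc)
  qed
  then show ?thesis by (simp add: fps_eq_iff)
qed

text \<open>This is what allows the \<open>THE\<close> in \<open>prob_lah\<close> to be
  evaluated.\<close>

lemma has_fps_expansion_unique:
  fixes F G :: "'a :: {banach, real_normed_field} fps"
  assumes "f has_fps_expansion F" and "f has_fps_expansion G"
  shows "F = G"
  using has_fps_expansion_zero_imp_zero[of "F - G"] has_fps_expansion_diff[OF assms] by simp

text \<open>The series \<open>G = fps_exp x - 1\<close> satisfies G' = x (G + 1), hence (G^(m+1))' =
  (m+1) x (G^(m+1) + G^m). Comparing coefficients turns this into the recurrence S(j+1,m+1) = (m+1)
  S(j,m+1) + S(j,m).\<close>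

lemma fps_nth_exp_minus_one_power:
  fixes x :: "'a :: field_char_0"
  shows "fact j * fps_nth ((fps_exp x - 1) ^ k) j = fact k * of_nat (Stirling j k) * x ^ j"
proof (induction j arbitrary: k)
  case 0
  show ?case by (cases k) simp_all
next
  case (Suc j)
  show ?case
  proof (cases k)
    case 0
    then show ?thesis by simp
  next
    case (Suc m)
    define G where "G = fps_exp x - 1"
    have "fps_deriv (G ^ Suc m) = fps_const (of_nat (Suc m)) * fps_deriv G * G ^ m"
      by (simp only: fps_deriv_power diff_Suc_1)
    also have "fps_deriv G = fps_const x * (G + 1)"
      by (simp add: G_def)
    also have "fps_const (of_nat (Suc m)) * (fps_const x * (G + 1)) * G ^ m
        = fps_const (of_nat (Suc m) * x) * (G ^ Suc m + G ^ m)"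
      unfolding fps_const_mult[symmetric] power_Suc by (simp only: algebra_simps mult_1_left)
    finally have "fps_deriv (G ^ Suc m) = fps_const (of_nat (Suc m) * x) * (G ^ Suc m + G ^ m)" .
    then have "fps_nth (fps_deriv (G ^ Suc m)) j
        = of_nat (Suc m) * x * (fps_nth (G ^ Suc m) j + fps_nth (G ^ m) j)"
      by (simp only: fps_mult_left_const_nth fps_add_nth)
    then have "fact (Suc j) * fps_nth (G ^ Suc m) (Suc j)
        = of_nat (Suc m) * x * (fact j * fps_nth (G ^ Suc m) j + fact j * fps_nth (G ^ m) j)"
      by (simp del: power_Suc of_nat_Suc add: algebra_simps)
    also have "\<dots> = of_nat (Suc m) * x *
        (fact (Suc m) * of_nat (Stirling j (Suc m)) * x ^ j + fact m * of_nat (Stirling j m) * x ^ j)"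
      using Suc.IH by (simp only: G_def)
    also have "\<dots> = fact (Suc m) * of_nat (Stirling (Suc j) (Suc m)) * x ^ Suc j"
      by (simp add: algebra_simps)
    finally show ?thesis by (simp only: G_def \<open>k = Suc m\<close>)
  qed
qed

lemma abs_pochhammer_le: "\<bar>pochhammer y n\<bar> \<le> pochhammer \<bar>y :: real\<bar> n"
  by (induction n) (auto simp: pochhammer_Suc abs_mult intro!: mult_mono)

text \<open>Newton's binomial series for (1 + (-t))^(-y): the sign (-1)^n in the binomial
  coefficient of -y cancels the one in (-t)^n.\<close>

lemma pochhammer_powser_sums:
  fixes y t :: real
  assumes "\<bar>t\<bar> < 1"
  shows "(\<lambda>n. pochhammer y n / fact n * t ^ n) sums (1 / (1 - t)) powr y"
proof -
  have "(- y gchoose n) * (- t) ^ n = pochhammer y n / fact n * t ^ n" for n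
    by (simp add: gbinomial_pochhammer flip: power_mult_distrib)
  moreover have "(1 + - t) powr (- y) = (1 / (1 - t)) powr y"
    using assms by (simp add: powr_minus powr_divide divide_simps)
  ultimately show ?thesis
    using gen_binomial_real[of "- t" "- y"] assms by simp
qed

lemma expectation_powr_sums:
  fixes Y :: "'a \<Rightarrow> real" and t :: real
  assumes [measurable]: "Y \<in> borel_measurable M"
    and t: "\<bar>t\<bar> < 1"
    and int: "integrable M (\<lambda>\<omega>. (1 / (1 - \<bar>t\<bar>)) powr \<bar>Y \<omega>\<bar>)"
  shows "(\<lambda>n. (integral\<^sup>L M (\<lambda>\<omega>. pochhammer (Y \<omega>) n) / fact n) * t ^ n)
    sums integral\<^sup>L M (\<lambda>\<omega>. (1 / (1 - t)) powr Y \<omega>)"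
proof -
  define f where "f n \<omega> = pochhammer (Y \<omega>) n / fact n * t ^ n" for n \<omega>
  define D where "D \<omega> = (1 / (1 - \<bar>t\<bar>)) powr \<bar>Y \<omega>\<bar>" for \<omega>
  have [measurable]: "f n \<in> borel_measurable M" for n
    unfolding f_def pochhammer_prod by measurable
  have f_le: "norm (f n \<omega>) \<le> pochhammer \<bar>Y \<omega>\<bar> n / fact n * \<bar>t\<bar> ^ n" for n \<omega>
    using abs_pochhammer_le[of "Y \<omega>" n]
    by (auto simp: f_def abs_mult power_abs intro!: divide_right_mono mult_right_mono)
  have D_sums: "(\<lambda>n. pochhammer \<bar>Y \<omega>\<bar> n / fact n * \<bar>t\<bar> ^ n) sums D \<omega>" for \<omega>
    unfolding D_def using t by (intro pochhammer_powser_sums) simp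
  have f_summable: "summable (\<lambda>n. norm (f n \<omega>))" for \<omega>
    by (rule summable_comparison_test'[of _ 0, OF sums_summable[OF D_sums]])
       (use f_le in auto)
  \<comment> \<open>Two kinds of index set are used below: singletons, for the integrability of each
    \<open>f n\<close>, and initial segments, for the summability of the integrals of the
    norms.\<close>
  have partial: "(\<Sum>i\<in>I. norm (f i \<omega>)) \<le> D \<omega>" if "finite I" for I \<omega>
  proof -
    have "(\<Sum>i\<in>I. norm (f i \<omega>)) \<le> (\<Sum>i. norm (f i \<omega>))"
      using that f_summable by (intro sum_le_suminf) auto
    also have "\<dots> \<le> D \<omega>"
      using sums_le[OF f_le summable_sums[OF f_summable] D_sums] .
    finally show ?thesis .
  qed
  have D_int: "integrable M D"
    using int unfolding D_def .
  have f_int: "integrable M (f n)" for n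
  proof (rule Bochner_Integration.integrable_bound[OF D_int])
    show "AE \<omega> in M. norm (f n \<omega>) \<le> norm (D \<omega>)"
      using partial[of "{n}"] by (auto simp: D_def)
  qed measurable
  have "summable (\<lambda>n. \<integral>\<omega>. norm (f n \<omega>) \<partial>M)"
  proof (rule summableI_nonneg_bounded)
    fix n
    have "(\<Sum>i<n. \<integral>\<omega>. norm (f i \<omega>) \<partial>M) = (\<integral>\<omega>. (\<Sum>i<n. norm (f i \<omega>)) \<partial>M)"
      using f_int by (intro Bochner_Integration.integral_sum[symmetric] integrable_norm)
    also have "\<dots> \<le> integral\<^sup>L M D"
      using f_int D_int partial
      by (intro integral_mono Bochner_Integration.integrable_sum integrable_norm) auto
    finally show "(\<Sum>i<n. \<integral>\<omega>. norm (f i \<omega>) \<partial>M) \<le> integral\<^sup>L M D" .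
  qed simp
  then have "(\<lambda>n. integral\<^sup>L M (f n)) sums (\<integral>\<omega>. (\<Sum>n. f n \<omega>) \<partial>M)"
    using f_int f_summable by (intro sums_integral) auto
  moreover have "(\<Sum>n. f n \<omega>) = (1 / (1 - t)) powr Y \<omega>" for \<omega>
    unfolding f_def using pochhammer_powser_sums[OF t] by (rule sums_unique[symmetric])
  moreover have "integral\<^sup>L M (f n) = integral\<^sup>L M (\<lambda>\<omega>. pochhammer (Y \<omega>) n) / fact n * t ^ n" for n
    by (simp add: f_def [abs_def])
  ultimately show ?thesis
    by simp
qed

text \<open>At each point exp (s |Y|) equals exp (s Y) or exp (-s Y), so their sum dominates it.
  This carries the hypothesis on the moment generating function over to |Y|.\<close>

lemma integrable_exp_abs:
  fixes Y :: "'a \<Rightarrow> real"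
  assumes [measurable]: "Y \<in> borel_measurable M"
    and "integrable M (\<lambda>\<omega>. exp (s * Y \<omega>))" "integrable M (\<lambda>\<omega>. exp (- s * Y \<omega>))"
  shows "integrable M (\<lambda>\<omega>. exp (s * \<bar>Y \<omega>\<bar>))"
proof (rule Bochner_Integration.integrable_bound)
  show "integrable M (\<lambda>\<omega>. exp (s * Y \<omega>) + exp (- s * Y \<omega>))"
    using assms by (intro Bochner_Integration.integrable_add)
  show "AE \<omega> in M. norm (exp (s * \<bar>Y \<omega>\<bar>)) \<le> norm (exp (s * Y \<omega>) + exp (- s * Y \<omega>))"
  proof (rule AE_I2)
    fix \<omega>
    show "norm (exp (s * \<bar>Y \<omega>\<bar>)) \<le> norm (exp (s * Y \<omega>) + exp (- s * Y \<omega>))"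
      by (cases "Y \<omega> \<ge> 0") (simp_all add: abs_of_pos add_pos_pos)
  qed
qed measurable

lemma expectation_powr_has_fps_expansion:
  fixes Y :: "'a \<Rightarrow> real" and r :: real
  assumes Y: "Y \<in> borel_measurable M"
    and r: "r > 0"
    and mgf: "\<And>t. \<bar>t\<bar> < r \<Longrightarrow> integrable M (\<lambda>\<omega>. exp (t * Y \<omega>))"
  shows "(\<lambda>t. integral\<^sup>L M (\<lambda>\<omega>. (1 / (1 - t)) powr Y \<omega>))
    has_fps_expansion Abs_fps (\<lambda>n. integral\<^sup>L M (\<lambda>\<omega>. pochhammer (Y \<omega>) n) / fact n)"
proof (rule has_fps_expansionI)
  \<comment> \<open>Chosen so that |t| < \<delta> amounts to -ln (1 - |t|) < r. The dominating
    function (1 - |t|)^(-|Y|) is then exp (s |Y|) for an exponent s within the range of the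
    hypothesis.\<close>
  define \<delta> where "\<delta> = 1 - exp (- r)"
  have "\<delta> > 0" using r by (simp add: \<delta>_def)
  then have "eventually (\<lambda>t. \<bar>t\<bar> < \<delta>) (nhds (0 :: real))"
    by (auto simp: eventually_nhds_metric dist_real_def)
  then show "eventually (\<lambda>t. (\<lambda>n. fps_nth (Abs_fps (\<lambda>n. integral\<^sup>L M
      (\<lambda>\<omega>. pochhammer (Y \<omega>) n) / fact n)) n * t ^ n)
      sums integral\<^sup>L M (\<lambda>\<omega>. (1 / (1 - t)) powr Y \<omega>)) (nhds 0)"
  proof eventually_elim
    case (elim t)
    have t: "\<bar>t\<bar> < 1"
      using elim exp_gt_zero[of "- r"] unfolding \<delta>_def by linarith
    define s where "s = - ln (1 - \<bar>t\<bar>)"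
    have "exp (- r) < 1 - \<bar>t\<bar>"
      using elim by (simp add: \<delta>_def)
    then have "- r < ln (1 - \<bar>t\<bar>)"
      using t by (metis exp_gt_zero ln_exp ln_less_cancel_iff order_less_trans)
    moreover have "ln (1 - \<bar>t\<bar>) \<le> 0"
      using t by simp
    ultimately have s: "\<bar>s\<bar> < r" "\<bar>- s\<bar> < r"
      by (simp_all add: s_def)
    have "(1 / (1 - \<bar>t\<bar>)) powr \<bar>Y \<omega>\<bar> = exp (s * \<bar>Y \<omega>\<bar>)" for \<omega>
      using t by (simp add: powr_def s_def ln_div)
    then have "integrable M (\<lambda>\<omega>. (1 / (1 - \<bar>t\<bar>)) powr \<bar>Y \<omega>\<bar>)"
      using integrable_exp_abs[OF Y mgf[OF s(1)] mgf[OF s(2)]] by simp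
    from expectation_powr_sums[OF Y t this] show ?case by simp
  qed
qed

text \<open>The function described in \<open>prob_lah\<close> expands as F^k / k!, and by uniqueness
  this is the series that \<open>THE\<close> selects.\<close>

lemma prob_lah_eq_fps_nth:
  assumes "(\<lambda>t. integral\<^sup>L M (\<lambda>\<omega>. (1 / (1 - t)) powr Y \<omega>) - 1) has_fps_expansion F"
  shows "prob_lah M Y n k = fact n / fact k * fps_nth (F ^ k) n"
proof -
  define f where "f = (\<lambda>t. integral\<^sup>L M (\<lambda>\<omega>. (1 / (1 - t)) powr Y \<omega>) - 1)"
  have "(\<lambda>t. f t ^ k) has_fps_expansion F ^ k"
    using assms by (induction k) (auto simp: f_def intro!: fps_expansion_intros)
  then have "(\<lambda>t. 1 / fact k * f t ^ k) has_fps_expansion fps_const (1 / fact k) * F ^ k"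
    by (rule has_fps_expansion_cmult_left)
  then have "(THE G. (\<lambda>t. 1 / fact k * f t ^ k) has_fps_expansion G)
      = fps_const (1 / fact k) * F ^ k"
    by (blast intro: has_fps_expansion_unique)
  then show ?thesis
    by (simp add: prob_lah_def f_def)
qed

theorem theorem2p10:
  fixes M :: "'a measure" and Y :: "'a \<Rightarrow> real" and r x :: real and n k :: nat
  assumes "prob_space M"
    and "Y \<in> borel_measurable M"
    and "r > 0"
    and "\<And>t::real. \<bar>t\<bar> < r \<Longrightarrow> integrable M (\<lambda>\<omega>. exp (t * Y \<omega>))"
    and "k \<le> n"
  shows "partial_bell n k (\<lambda>j. prob_lah_bell M Y j x)
    = (\<Sum>j=k..n. real (Stirling j k) * prob_lah M Y n j * x ^ j)"
proof -
  interpret prob_space M by fact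
  define F where "F = Abs_fps (\<lambda>n. expectation (\<lambda>\<omega>. pochhammer (Y \<omega>) n) / fact n) - 1"
  have "(\<lambda>t. expectation (\<lambda>\<omega>. (1 / (1 - t)) powr Y \<omega>) - 1) has_fps_expansion F"
    unfolding F_def
    by (intro has_fps_expansion_diff has_fps_expansion_1
        expectation_powr_has_fps_expansion[OF assms(2-4)])
  then have lah: "prob_lah M Y m j = fact m / fact j * fps_nth (F ^ j) m" for m j
    by (rule prob_lah_eq_fps_nth)
  \<comment> \<open>The term n = 0 is the expectation of the constant 1, which is 1 on a probability
    space. A vanishing constant term is what makes composition with \<open>F\<close> commute with
    powers.\<close>
  have F0: "fps_nth F 0 = 0"
    by (simp add: F_def prob_space)
  \<comment> \<open>For m > 0 the m-th coefficient of exp (x F) is the sum of x^j / j! times that of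
    F^j, which is the Lah-Bell polynomial over m!. Subtracting 1 accounts for the entry 0 at index
    0.\<close>
  have "Abs_fps (\<lambda>j. if j = 0 then 0 else prob_lah_bell M Y j x / fact j) = (fps_exp x - 1) oo F"
  proof (rule fps_ext)
    fix m
    show "fps_nth (Abs_fps (\<lambda>j. if j = 0 then 0 else prob_lah_bell M Y j x / fact j)) m
        = fps_nth ((fps_exp x - 1) oo F) m"
    proof (cases "m = 0")
      case False
      have "prob_lah_bell M Y m x / fact m = fps_nth (fps_exp x oo F) m"
        by (simp add: prob_lah_bell_def lah fps_compose_nth sum_divide_distrib mult_ac)
      with False show ?thesis
        by (simp add: fps_compose_sub_distrib)
    qed simp
  qed
  then have "partial_bell n k (\<lambda>j. prob_lah_bell M Y j x)
      = fact n / fact k * fps_nth ((fps_exp x - 1) ^ k oo F) n"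
    by (simp add: partial_bell_def fps_compose_power[OF F0])
  also have "\<dots> = (\<Sum>j=0..n. fact n / fact k * fps_nth ((fps_exp x - 1) ^ k) j * fps_nth (F ^ j) n)"
    by (simp add: fps_compose_nth sum_distrib_left mult.assoc)
  also have "\<dots> = (\<Sum>j=0..n. real (Stirling j k) * prob_lah M Y n j * x ^ j)"
  proof (rule sum.cong)
    fix j
    have "fps_nth ((fps_exp x - 1) ^ k) j = fact k * real (Stirling j k) * x ^ j / fact j"
      using fps_nth_exp_minus_one_power[of j x k] by (simp add: field_simps)
    then show "fact n / fact k * fps_nth ((fps_exp x - 1) ^ k) j * fps_nth (F ^ j) n
        = real (Stirling j k) * prob_lah M Y n j * x ^ j"
      by (simp add: lah)
  qed simp
  \<comment> \<open>The terms with j < k vanish because \<open>Stirling j k = 0\<close>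
    there.\<close>
  also have "\<dots> = (\<Sum>j=k..n. real (Stirling j k) * prob_lah M Y n j * x ^ j)"
    by (rule sum.mono_neutral_right) auto
  finally show ?thesis .
qed

end
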